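(* Let $X$ be a countable compact metric space. Then there exists a finite approximative sequence (FAS) $(\varepsilon_n,A_n)_{n\in\mathbb{N}}$ of $X$ such that its inverse limit $\mathcal{X}=\varprojlim\left(U_{2\varepsilon_n}(A_n),p_{n,n+1}\right)_{n\in\mathbb{N}}$ is homeomorphic to $X$.
   Context: Let $(X,\mathrm{d})$ be a compact metric space and $\mathbb{N}=\{1,2,\ldots\}$. For $\varepsilon>0$, a finite $\varepsilon$-approximation of $X$ is a finite subset $A\subset X$ such that for every $x\in X$ there is $a\in A$ with $\mathrm{d}(x,a)<\varepsilon$. A finite approximative sequence (FAS) of $X$ is a pair of sequences $(\varepsilon_n,A_n)_{n\in\mathbb{N}}$, where $(\varepsilon_n)$ is a decreasing sequence of positive real numbers tending to $0$, each $A_n$ is a finite $\varepsilon_n$-approximation of $X$, and for every $n$, $\varepsilon_{n+1}<\frac{\varepsilon_n-\gamma_n}{2}$, where $\gamma_n=\sup\{\mathrm{d}(x,A_n):x\in X\}$ (which is $<\varepsilon_n$). For a FAS, $U_{2\varepsilon_n}(A_n)=\{C\subseteq A_n: C\neq\emptyset,\ \mathrm{diam}(C)<2\varepsilon_n\}$, with the upper semifinite topology: it is the finite $T_0$ space in which the minimal open neighborhood of $C$ is $\{D: \emptyset\neq D\subseteq C\}$ (so the open sets are exactly the sets closed under taking nonempty subsets). The bonding maps are the continuous maps $p_{n,n+1}:U_{2\varepsilon_{n+1}}(A_{n+1})\to U_{2\varepsilon_n}(A_n)$, $p_{n,n+1}(C)=\bigcup_{c\in C}\{a\in A_n:\mathrm{d}(a,c)=\mathrm{d}(A_n,c)\}$.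 The inverse limit is $\mathcal{X}=\{(C_n)_{n\in\mathbb{N}}\in\prod_n U_{2\varepsilon_n}(A_n): p_{n,n+1}(C_{n+1})=C_n\ \forall n\}$ with the subspace topology of the product topology. *)

theory Defs
  imports "HOL-Analysis.Analysis"
begin

definition finite_approximation :: "'a::metric_space set \<Rightarrow> real \<Rightarrow> 'a set \<Rightarrow> bool" where
  "finite_approximation X \<epsilon> A \<longleftrightarrow>
     finite A \<and> A \<subseteq> X \<and> (\<forall>x\<in>X. \<exists>a\<in>A. dist x a < \<epsilon>)"

(* The supremum is taken in [0, infinity), so it is 0 for empty X, where the
   supremum over the reals would be unspecified. *)
definition covering_radius :: "'a::metric_space set \<Rightarrow> 'a set \<Rightarrow> real" where
  "covering_radius X A = (if X = {} then 0 else SUP x\<in>X. infdist x A)"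

(* Sequences are indexed from 0 instead of from 1. *)
definition finite_approximative_sequence ::
    "'a::metric_space set \<Rightarrow> (nat \<Rightarrow> real) \<Rightarrow> (nat \<Rightarrow> 'a set) \<Rightarrow> bool" where
  "finite_approximative_sequence X \<epsilon> A \<longleftrightarrow>
     (\<forall>n. 0 < \<epsilon> n) \<and> decseq \<epsilon> \<and> \<epsilon> \<longlonglongrightarrow> 0 \<and>
     (\<forall>n. finite_approximation X (\<epsilon> n) (A n)) \<and>
     (\<forall>n. \<epsilon> (Suc n) < (\<epsilon> n - covering_radius X (A n)) / 2)"

definition small_subsets :: "real \<Rightarrow> 'a::metric_space set \<Rightarrow> 'a set set" where
  "small_subsets r A = {C. C \<subseteq> A \<and> C \<noteq> {} \<and> diameter C < r}"

definition upper_semifinite_topology :: "'a set set \<Rightarrow> 'a set topology" where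
  "upper_semifinite_topology U =
     topology (\<lambda>W. W \<subseteq> U \<and> (\<forall>C\<in>W. \<forall>D\<in>U. D \<subseteq> C \<longrightarrow> D \<in> W))"

lemma openin_upper_semifinite_topology:
  "openin (upper_semifinite_topology U) W \<longleftrightarrow>
     W \<subseteq> U \<and> (\<forall>C\<in>W. \<forall>D\<in>U. D \<subseteq> C \<longrightarrow> D \<in> W)"
proof -
  have "istopology (\<lambda>W. W \<subseteq> U \<and> (\<forall>C\<in>W. \<forall>D\<in>U. D \<subseteq> C \<longrightarrow> D \<in> W))"
    unfolding istopology_def by blast
  then show ?thesis
    by (simp add: upper_semifinite_topology_def topology_inverse')
qed

lemma topspace_upper_semifinite_topology:
  "topspace (upper_semifinite_topology U) = U"
  unfolding topspace_def openin_upper_semifinite_topology by blast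

(* For finite A the family is closed under nonempty subsets, so the relativisation
   to U in the definition of the topology is immaterial there. *)
lemma small_subsets_subset:
  assumes "finite A" "C \<in> small_subsets r A" "D \<subseteq> C" "D \<noteq> {}"
  shows "D \<in> small_subsets r A"
proof -
  have "finite C"
    using assms(1,2) finite_subset by (auto simp: small_subsets_def)
  then have "diameter D \<le> diameter C"
    by (simp add: assms(3) diameter_subset finite_imp_bounded)
  then show ?thesis
    using assms by (auto simp: small_subsets_def)
qed

definition nearest_points_map :: "'a::metric_space set \<Rightarrow> 'a set \<Rightarrow> 'a set" where
  "nearest_points_map A C = (\<Union>c\<in>C. {a\<in>A. dist a c = infdist c A})"

definition inverse_limit_topology ::
    "(nat \<Rightarrow> 'b topology) \<Rightarrow> (nat \<Rightarrow> 'b \<Rightarrow> 'b) \<Rightarrow> (nat \<Rightarrow> 'b) topology" where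
  "inverse_limit_topology T p =
     subtopology (product_topology T UNIV)
       {C. (\<forall>n. C n \<in> topspace (T n)) \<and> (\<forall>n. p n (C (Suc n)) = C n)}"

definition FAS_inverse_limit ::
    "(nat \<Rightarrow> real) \<Rightarrow> (nat \<Rightarrow> 'a::metric_space set) \<Rightarrow> (nat \<Rightarrow> 'a set) topology" where
  "FAS_inverse_limit \<epsilon> A =
     inverse_limit_topology
       (\<lambda>n. upper_semifinite_topology (small_subsets (2 * \<epsilon> n) (A n)))
       (\<lambda>n. nearest_points_map (A n))"

end

theory Submission
  imports Defs
begin

text \<open>
  Every thread \<open>C\<close> of the inverse limit shrinks to a single point of \<open>X\<close>: consecutive levels
  \<open>C n\<close>, \<open>C (Suc n)\<close> are at most \<open>3 * \<epsilon> n\<close> apart, and \<open>\<epsilon>\<close> decays geometrically. The resulting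
  map from threads to \<open>X\<close> is in general not injective, because near a point \<open>x\<close> the nearest
  points of \<open>A n\<close> may jump, and several threads can then converge to \<open>x\<close>.

  No such jump occurs at the points of \<open>A n\<close> itself: the points close to \<open>x \<in> A n\<close>
  have \<open>x\<close> as their only nearest point in \<open>A n\<close>, where ``close'' depends on the minimal distance
  between points of the finite set \<open>A n\<close>. Since \<open>X\<close> is countable, the finite
  sets \<open>A n\<close> can be chosen so that every point of \<open>X\<close> lies in all but finitely many of them, and
  \<open>\<epsilon> (Suc n)\<close> can be chosen small compared with the separation of \<open>A n\<close>. For such a sequence a
  thread converging to \<open>x\<close> is \<open>{x}\<close> at every late level, hence determined by \<open>x\<close>. The same
  computation applies to threads converging to a point \<open>y\<close> near \<open>x\<close>
  (\<open>thread_collapses\<close>), so each level of the thread of \<open>y\<close> is a locally constant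
  function of \<open>y\<close>. Taking limits of threads is therefore a bijection onto \<open>X\<close> that is
  continuous in both directions.
\<close>

section \<open>Covering radii of finite approximations\<close>

lemma infdist_le_covering_radius:
  assumes "compact X" "x \<in> X"
  shows "infdist x A \<le> covering_radius X A"
proof -
  have "compact ((\<lambda>x. infdist x A) ` X)"
    using assms(1) by (intro compact_continuous_image continuous_intros)
  then have "bdd_above ((\<lambda>x. infdist x A) ` X)"
    by (simp add: bounded_imp_bdd_above compact_imp_bounded)
  then show ?thesis
    using assms(2) by (auto simp: covering_radius_def intro: cSUP_upper)
qed

lemma covering_radius_nonneg:
  assumes "compact X"
  shows "0 \<le> covering_radius X A"
proof (cases "X = {}")
  case False
  then obtain x where "x \<in> X" by blast
  then show ?thesis
    using infdist_le_covering_radius[OF assms] infdist_nonneg[of x A] order_trans by blast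
qed (simp add: covering_radius_def)

text \<open>
  The bound is strict because the supremum is attained on the compact set \<open>X\<close>. This
  strictness leaves room for a positive next radius in the recursive choice of a sequence.
\<close>

lemma covering_radius_less:
  assumes "compact X" "0 < e" "finite_approximation X e A"
  shows "covering_radius X A < e"
proof (cases "X = {}")
  case False
  have "continuous_on X (\<lambda>x. infdist x A)"
    by (intro continuous_intros)
  then obtain x where x: "x \<in> X" "\<forall>y\<in>X. infdist y A \<le> infdist x A"
    using continuous_attains_sup[OF assms(1) False] by blast
  obtain a where "a \<in> A" "dist x a < e"
    using assms(3) x(1) by (auto simp: finite_approximation_def)
  then have "infdist x A < e"
    using infdist_le order_le_less_trans by blast
  moreover have "covering_radius X A \<le> infdist x A"
    using False x(2) by (auto simp: covering_radius_def intro: cSUP_least)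
  ultimately show ?thesis by simp
qed (simp add: covering_radius_def assms)

lemma nearest_point_exists:
  assumes "finite A" "A \<noteq> {}"
  obtains a where "a \<in> A" "dist a c = infdist c A"
proof -
  obtain a where a: "a \<in> A" "\<forall>b\<in>A. dist c a \<le> dist c b"
    using ex_min_if_finite[of "dist c ` A"] assms by (auto simp: not_less)
  then have "infdist c A = dist c a"
    using assms(2) by (auto simp: infdist_def intro: cInf_eq_minimum)
  then show ?thesis
    using a(1) that by (simp add: dist_commute)
qed

section \<open>Threads of a separated exhausting sequence\<close>

text \<open>
  Besides the conditions on a finite approximative sequence, points of \<open>A n\<close> are
  far apart on the next scale, and every point of \<open>X\<close> eventually belongs to the \<open>A n\<close>. The factor
  14 is twice 7: a thread converging to \<open>y\<close> stays within \<open>6 * \<epsilon> n\<close> of \<open>y\<close> at level \<open>n\<close>, and one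
  further \<open>\<epsilon>\<close> accounts for moving from \<open>y\<close> to a neighbouring point \<open>x\<close>.
\<close>

locale separated_exhausting_FAS =
  fixes X :: "'a::metric_space set" and \<epsilon> :: "nat \<Rightarrow> real" and A :: "nat \<Rightarrow> 'a set"
  assumes compact: "compact X"
    and pos: "0 < \<epsilon> n"
    and approx: "finite_approximation X (\<epsilon> n) (A n)"
    and gap: "\<epsilon> (Suc n) < (\<epsilon> n - covering_radius X (A n)) / 2"
    and separated: "a \<in> A n \<Longrightarrow> b \<in> A n \<Longrightarrow> a \<noteq> b \<Longrightarrow> 14 * \<epsilon> (Suc n) < dist a b"
    and exhausting: "x \<in> X \<Longrightarrow> \<exists>N. \<forall>n\<ge>N. x \<in> A n"
begin

lemma half: "\<epsilon> (Suc n) < \<epsilon> n / 2"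
  using gap[of n] covering_radius_nonneg[OF compact, of "A n"] by simp

lemma decseq: "decseq \<epsilon>"
proof (rule decseq_SucI)
  show "\<epsilon> (Suc n) \<le> \<epsilon> n" for n
    using half[of n] pos[of n] by simp
qed

lemma tendsto_zero: "\<epsilon> \<longlonglongrightarrow> 0"
proof (rule tendsto_sandwich)
  have "\<epsilon> n \<le> \<epsilon> 0 * (1/2) ^ n" for n
  proof (induction n)
    case (Suc n)
    then show ?case using half[of n] by simp
  qed simp
  then show "\<forall>\<^sub>F n in sequentially. \<epsilon> n \<le> \<epsilon> 0 * (1/2) ^ n" by simp
  show "\<forall>\<^sub>F n in sequentially. 0 \<le> \<epsilon> n"
    using pos by (simp add: less_imp_le)
  show "(\<lambda>n. \<epsilon> 0 * (1/2) ^ n) \<longlonglongrightarrow> 0"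
    by (intro tendsto_mult_right_zero LIMSEQ_power_zero) simp
qed simp

lemma scale_below:
  assumes "0 < e"
  obtains n where "N \<le> n" "\<epsilon> n < e"
proof -
  have "\<forall>\<^sub>F n in sequentially. \<epsilon> n < e"
    using order_tendstoD(2)[OF tendsto_zero assms] .
  then have "\<forall>\<^sub>F n in sequentially. N \<le> n \<and> \<epsilon> n < e"
    using eventually_ge_at_top by eventually_elim simp
  then show ?thesis
    using that eventually_happens' sequentially_bot by blast
qed

lemma is_FAS: "finite_approximative_sequence X \<epsilon> A"
  using pos decseq tendsto_zero approx gap by (simp add: finite_approximative_sequence_def)

lemma finite_level: "finite (A n)" and level_subset: "A n \<subseteq> X"
  using approx[of n] by (auto simp: finite_approximation_def)

lemma infdist_less: "x \<in> X \<Longrightarrow> infdist x (A n) < \<epsilon> n"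
  using infdist_le_covering_radius[OF compact, of x "A n"]
    covering_radius_less[OF compact pos approx, of n] by simp

abbreviation level :: "nat \<Rightarrow> 'a set set" where
  "level n \<equiv> small_subsets (2 * \<epsilon> n) (A n)"

lemma levelD:
  assumes "C \<in> level n"
  shows "C \<subseteq> A n" "C \<subseteq> X" "C \<noteq> {}" "finite C"
proof -
  show *: "C \<subseteq> A n" "C \<noteq> {}"
    using assms by (auto simp: small_subsets_def)
  show "C \<subseteq> X" "finite C"
    using order_trans[OF *(1) level_subset] finite_subset[OF *(1) finite_level] .
qed

lemma dist_level:
  assumes "C \<in> level n" "a \<in> C" "b \<in> C"
  shows "dist a b < 2 * \<epsilon> n"
proof -
  have "dist a b \<le> diameter C"
    using levelD(4)[OF assms(1)] assms(2,3)
    by (intro diameter_bounded_bound finite_imp_bounded)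
  then show ?thesis
    using assms(1) by (simp add: small_subsets_def)
qed

lemma levelI:
  assumes "C \<subseteq> A n" "C \<noteq> {}" "\<And>a b. a \<in> C \<Longrightarrow> b \<in> C \<Longrightarrow> dist a b \<le> r" "r < 2 * \<epsilon> n"
  shows "C \<in> level n"
proof -
  have "diameter C \<le> r"
    using assms(2,3) by (auto simp: diameter_def intro!: cSUP_least)
  then show ?thesis
    using assms by (simp add: small_subsets_def)
qed

text \<open>
  The bonding maps respect the diameter bounds: passing to nearest points adds at most the
  covering radius \<open>\<gamma>\<close> at either end, and the gap condition gives
  \<open>2 * \<gamma> + 2 * \<epsilon> (Suc n) < \<gamma> + \<epsilon> n < 2 * \<epsilon> n\<close>.
\<close>

lemma nearest_points_map_level:
  assumes C: "C \<in> level (Suc n)"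
  shows "nearest_points_map (A n) C \<in> level n"
proof (rule levelI)
  let ?r = "covering_radius X (A n)"
  obtain c where c: "c \<in> C" "c \<in> X" using levelD[OF C] by blast
  then have "A n \<noteq> {}"
    using approx[of n] by (auto simp: finite_approximation_def)
  then show "nearest_points_map (A n) C \<noteq> {}"
    using nearest_point_exists[OF finite_level, of n c] c(1)
    by (auto simp: nearest_points_map_def)
  show "2 * ?r + 2 * \<epsilon> (Suc n) < 2 * \<epsilon> n"
    using gap[of n] covering_radius_less[OF compact pos approx, of n] by simp
  fix a b
  assume "a \<in> nearest_points_map (A n) C" "b \<in> nearest_points_map (A n) C"
  then obtain c d where cd: "c \<in> C" "d \<in> C"
    "dist a c = infdist c (A n)" "dist b d = infdist d (A n)"
    by (auto simp: nearest_points_map_def)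
  then have "dist a c \<le> ?r" "dist b d \<le> ?r"
    using infdist_le_covering_radius[OF compact] levelD(2)[OF C] by auto
  moreover have "dist c d < 2 * \<epsilon> (Suc n)"
    using dist_level[OF C] cd by blast
  moreover have "dist a b \<le> dist a c + dist c d + dist b d"
    by metric
  ultimately show "dist a b \<le> 2 * ?r + 2 * \<epsilon> (Suc n)" by simp
qed (auto simp: nearest_points_map_def)

definition threads :: "(nat \<Rightarrow> 'a set) set" where
  "threads = {C. (\<forall>n. C n \<in> level n) \<and> (\<forall>n. nearest_points_map (A n) (C (Suc n)) = C n)}"

lemma threadD:
  assumes "C \<in> threads"
  shows "C n \<in> level n" "nearest_points_map (A n) (C (Suc n)) = C n"
  using assms by (simp_all add: threads_def)

lemma thread_eq_below:
  assumes "C \<in> threads" "D \<in> threads" "C n = D n" "k \<le> n"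
  shows "C k = D k"
  using assms(4,3)
proof (induction k rule: inc_induct)
  case (step k)
  then show ?case using threadD(2)[OF assms(1), of k] threadD(2)[OF assms(2), of k] by simp
qed simp

lemma dist_thread_Suc:
  assumes C: "C \<in> threads" and a: "a \<in> C n" and b: "b \<in> C (Suc n)"
  shows "dist a b < 3 * \<epsilon> n"
proof -
  have "A n \<noteq> {}"
    using levelD[OF threadD(1)[OF C, of n]] by blast
  then obtain a' where a': "a' \<in> A n" "dist a' b = infdist b (A n)"
    using nearest_point_exists[OF finite_level] by blast
  then have "a' \<in> nearest_points_map (A n) (C (Suc n))"
    using b by (auto simp: nearest_points_map_def)
  then have "dist a a' < 2 * \<epsilon> n"
    using threadD[OF C] dist_level a by metis
  moreover have "dist a' b < \<epsilon> n"
    using a'(2) infdist_less levelD(2)[OF threadD(1)[OF C, of "Suc n"]] b by auto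
  ultimately show ?thesis
    using dist_triangle[of a b a'] by simp
qed

text \<open>
  The radii at least halve from one level to the next, so the steps of the previous bound add up
  to \<open>3 * \<epsilon> n * (1 + 1/2 + 1/4 + \<dots>) = 6 * \<epsilon> n\<close>.
\<close>

lemma dist_thread:
  assumes C: "C \<in> threads" and "n \<le> m" "a \<in> C n" and b: "b \<in> C m"
  shows "dist a b \<le> 6 * \<epsilon> n"
  using assms(2,3)
proof (induction n arbitrary: a rule: inc_induct)
  case base
  then show ?case using dist_level[OF threadD(1)[OF C] _ b] pos[of m] by fastforce
next
  case (step n)
  obtain c where c: "c \<in> C (Suc n)"
    using levelD(3)[OF threadD(1)[OF C]] by blast
  then have "dist c b \<le> 6 * \<epsilon> (Suc n)" "dist a c < 3 * \<epsilon> n"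
    using step dist_thread_Suc[OF C] by auto
  then show ?case
    using half[of n] dist_triangle[of a b c] by simp
qed

text \<open>
  Any choice of points from the levels of \<open>C\<close> has a convergent subsequence by compactness, and
  the bound between arbitrary levels survives in the limit.
\<close>

lemma thread_converges:
  assumes C: "C \<in> threads"
  shows "\<exists>x\<in>X. \<forall>n. C n \<subseteq> cball x (6 * \<epsilon> n)"
proof -
  have "\<forall>n. \<exists>a. a \<in> C n"
    using levelD(3)[OF threadD(1)[OF C]] by blast
  then obtain a where a: "\<And>n. a n \<in> C n" by metis
  have aX: "a n \<in> X" for n
    using levelD(2)[OF threadD(1)[OF C]] a by blast
  then obtain x r where x: "x \<in> X" "strict_mono (r :: nat \<Rightarrow> nat)" "(a \<circ> r) \<longlonglongrightarrow> x"
    using compact by (metis compact_def)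
  have "dist x c \<le> 6 * \<epsilon> n" if c: "c \<in> C n" for n c
  proof (rule tendsto_upperbound)
    show "(\<lambda>k. dist ((a \<circ> r) k) c) \<longlonglongrightarrow> dist x c"
      by (intro tendsto_intros x)
    have "dist ((a \<circ> r) k) c \<le> 6 * \<epsilon> n" if "n \<le> k" for k
      using dist_thread[OF C _ c a, of "r k"] strict_mono_imp_increasing[OF x(2), of k] that
      by (simp add: dist_commute)
    then show "\<forall>\<^sub>F k in sequentially. dist ((a \<circ> r) k) c \<le> 6 * \<epsilon> n"
      by (auto simp: eventually_sequentially)
  qed simp
  then show ?thesis using x(1) by (auto simp: subset_iff)
qed

text \<open>
  The key step. Level \<open>Suc n\<close> of a thread converging to \<open>y\<close> lies so close to \<open>x\<close>, on the scale of
  the separation of \<open>A n\<close>, that \<open>x\<close> is the only point of \<open>A n\<close> nearest to any of its points.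
  With \<open>y = x\<close> this makes threads unique; with \<open>y\<close> merely near \<open>x\<close> it makes
  them locally constant.
\<close>

lemma thread_collapses:
  assumes C: "C \<in> threads" and y: "\<And>n. C n \<subseteq> cball y (6 * \<epsilon> n)"
    and x: "x \<in> A n" "dist x y < \<epsilon> (Suc n)"
  shows "C n = {x}"
proof -
  have "a = x" if "a \<in> C n" for a
  proof (rule ccontr)
    assume "a \<noteq> x"
    have "a \<in> nearest_points_map (A n) (C (Suc n))"
      using that threadD(2)[OF C] by simp
    then obtain c where c: "c \<in> C (Suc n)" "a \<in> A n" "dist a c = infdist c (A n)"
      by (auto simp: nearest_points_map_def)
    have "dist y c \<le> 6 * \<epsilon> (Suc n)"
      using y c(1) by (auto simp: subset_iff)
    then have "dist x c < 7 * \<epsilon> (Suc n)"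
      using x(2) dist_triangle[of x c y] by simp
    moreover have "dist a c \<le> dist x c"
      using c(3) infdist_le[OF x(1), of c] by (simp add: dist_commute)
    moreover have "14 * \<epsilon> (Suc n) < dist a x"
      using separated[OF c(2) x(1) \<open>a \<noteq> x\<close>] .
    ultimately show False
      using dist_triangle2[of a x c] by simp
  qed
  then show ?thesis
    using levelD(3)[OF threadD(1)[OF C, of n]] by blast
qed

section \<open>The homeomorphism\<close>

definition thread_limit :: "(nat \<Rightarrow> 'a set) \<Rightarrow> 'a" where
  "thread_limit C = (SOME x. x \<in> X \<and> (\<forall>n. C n \<subseteq> cball x (6 * \<epsilon> n)))"

lemma thread_limit:
  assumes "C \<in> threads"
  shows "thread_limit C \<in> X" "C n \<subseteq> cball (thread_limit C) (6 * \<epsilon> n)"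
proof -
  have "thread_limit C \<in> X \<and> (\<forall>n. C n \<subseteq> cball (thread_limit C) (6 * \<epsilon> n))"
    unfolding thread_limit_def by (rule someI_ex) (use thread_converges[OF assms] in blast)
  then show "thread_limit C \<in> X" "C n \<subseteq> cball (thread_limit C) (6 * \<epsilon> n)" by auto
qed

definition entry :: "'a \<Rightarrow> nat" where
  "entry x = (SOME N. \<forall>n\<ge>N. x \<in> A n)"

lemma entry: "x \<in> X \<Longrightarrow> entry x \<le> n \<Longrightarrow> x \<in> A n"
  unfolding entry_def using someI_ex[OF exhausting] by blast

text \<open>The composite of the bonding maps from level \<open>n + k\<close> down to level \<open>n\<close>.\<close>

fun pull :: "nat \<Rightarrow> nat \<Rightarrow> 'a set \<Rightarrow> 'a set" where
  "pull n 0 S = S"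
| "pull n (Suc k) S = nearest_points_map (A n) (pull (Suc n) k S)"

text \<open>
  The thread of \<open>x\<close> is \<open>{x}\<close> at each level from \<open>entry x\<close> on, where \<open>x\<close> is its own nearest point;
  the truncated subtraction covers both this range and the levels below it.
\<close>

definition point_thread :: "'a \<Rightarrow> nat \<Rightarrow> 'a set" where
  "point_thread x n = pull n (entry x - n) {x}"

lemma pull_level: "S \<in> level (n + k) \<Longrightarrow> pull n k S \<in> level n"
  by (induction k arbitrary: n) (auto intro: nearest_points_map_level)

lemma point_thread_above: "entry x \<le> n \<Longrightarrow> point_thread x n = {x}"
  by (simp add: point_thread_def)

lemma nearest_points_map_singleton: "x \<in> A n \<Longrightarrow> nearest_points_map (A n) {x} = {x}"
  by (auto simp: nearest_points_map_def)

lemma point_thread: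
  assumes "x \<in> X"
  shows "point_thread x \<in> threads"
proof -
  have "point_thread x n \<in> level n" for n
  proof -
    have "{x} \<in> level (n + (entry x - n))"
      using entry[OF assms] pos by (intro levelI[where r = 0]) auto
    then show ?thesis
      unfolding point_thread_def by (rule pull_level)
  qed
  moreover have "nearest_points_map (A n) (point_thread x (Suc n)) = point_thread x n" for n
  proof (cases "entry x \<le> n")
    case True
    then show ?thesis
      using nearest_points_map_singleton[OF entry[OF assms True]] by (simp add: point_thread_above)
  next
    case False
    then have "entry x - n = Suc (entry x - Suc n)" by simp
    then show ?thesis by (simp add: point_thread_def)
  qed
  ultimately show ?thesis by (simp add: threads_def)
qed

lemma thread_limit_point_thread:
  assumes "x \<in> X"
  shows "thread_limit (point_thread x) = x"
proof (rule ccontr)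
  let ?y = "thread_limit (point_thread x)"
  assume "?y \<noteq> x"
  then have "0 < dist ?y x / 6" by simp
  then obtain n where n: "entry x \<le> n" "\<epsilon> n < dist ?y x / 6"
    by (rule scale_below)
  have "{x} \<subseteq> cball ?y (6 * \<epsilon> n)"
    using thread_limit(2)[OF point_thread[OF assms], of n] point_thread_above[OF n(1)] by simp
  then show False using n(2) by simp
qed

text \<open>
  At a level \<open>m\<close> with \<open>x \<in> A m\<close>, threads of points near \<open>x\<close> collapse to \<open>{x}\<close>, and a thread is
  determined below \<open>m\<close> by its entry there.
\<close>

lemma point_thread_locally_constant:
  assumes x: "x \<in> X"
  shows "\<exists>d>0. \<forall>y\<in>X. dist y x < d \<longrightarrow> point_thread y n = point_thread x n"
proof (intro exI conjI ballI impI)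
  let ?m = "max n (entry x)"
  show "0 < \<epsilon> (Suc ?m)" by (rule pos)
  fix y assume y: "y \<in> X" "dist y x < \<epsilon> (Suc ?m)"
  have "point_thread y ?m = {x}"
  proof (rule thread_collapses[OF point_thread[OF y(1)]])
    show "point_thread y k \<subseteq> cball y (6 * \<epsilon> k)" for k
      using thread_limit(2)[OF point_thread[OF y(1)]] thread_limit_point_thread[OF y(1)] by simp
  qed (use y entry[OF x] in \<open>auto simp: dist_commute\<close>)
  also have "\<dots> = point_thread x ?m"
    by (simp add: point_thread_above)
  finally show "point_thread y n = point_thread x n"
    by (rule thread_eq_below[OF point_thread[OF y(1)] point_thread[OF x]]) simp
qed

lemma point_thread_thread_limit:
  assumes "C \<in> threads"
  shows "point_thread (thread_limit C) = C"
proof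
  fix k
  let ?x = "thread_limit C"
  let ?n = "max k (entry ?x)"
  note x = thread_limit(1)[OF assms]
  have "C ?n = {?x}"
    by (rule thread_collapses[OF assms thread_limit(2)[OF assms]]) (auto intro: entry[OF x] pos)
  then have "point_thread ?x ?n = C ?n"
    by (simp add: point_thread_above)
  then show "point_thread ?x k = C k"
    by (rule thread_eq_below[OF point_thread[OF x] assms]) simp
qed

lemma FAS_inverse_limit_eq:
  "FAS_inverse_limit \<epsilon> A =
     subtopology (product_topology (\<lambda>n. upper_semifinite_topology (level n)) UNIV) threads"
  by (simp add: FAS_inverse_limit_def inverse_limit_topology_def threads_def
      topspace_upper_semifinite_topology)

lemma topspace_inverse_limit: "topspace (FAS_inverse_limit \<epsilon> A) = threads"
  by (auto simp: FAS_inverse_limit_eq topspace_upper_semifinite_topology threads_def PiE_def)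

lemma continuous_map_point_thread:
  "continuous_map (top_of_set X) (FAS_inverse_limit \<epsilon> A) point_thread"
proof -
  have "continuous_map (top_of_set X) (upper_semifinite_topology (level n))
          (\<lambda>x. point_thread x n)" for n
    unfolding continuous_map_def
  proof (intro conjI allI impI)
    show "(\<lambda>x. point_thread x n) \<in>
        topspace (top_of_set X) \<rightarrow> topspace (upper_semifinite_topology (level n))"
      using threadD(1)[OF point_thread] by (auto simp: topspace_upper_semifinite_topology)
    fix W
    show "openin (top_of_set X) {x \<in> topspace (top_of_set X). point_thread x n \<in> W}"
      unfolding openin_euclidean_subtopology_iff
    proof (intro conjI ballI)
      fix x assume x: "x \<in> {x \<in> topspace (top_of_set X). point_thread x n \<in> W}"
      then have "x \<in> X" "point_thread x n \<in> W" by auto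
      then obtain d where d: "d > 0"
          "\<And>y. y \<in> X \<Longrightarrow> dist y x < d \<Longrightarrow> point_thread y n \<in> W"
        using point_thread_locally_constant[of x n] by metis
      then show "\<exists>e>0. \<forall>x'\<in>X. dist x' x < e \<longrightarrow>
          x' \<in> {x \<in> topspace (top_of_set X). point_thread x n \<in> W}"
        by (intro exI[of _ d]) auto
    qed auto
  qed
  then show ?thesis
    unfolding FAS_inverse_limit_eq continuous_map_in_subtopology continuous_map_componentwise_UNIV
    using point_thread by (simp add: image_subset_iff)
qed

text \<open>
  These neighbourhoods come from the minimal open neighbourhood of \<open>C n\<close> in level \<open>n\<close>. They
  suffice for the continuity of limits, since a point of \<open>D n \<subseteq> C n\<close> is within \<open>6 * \<epsilon> n\<close> of the
  limits of both threads.
\<close>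

lemma openin_thread_neighbourhood:
  assumes "C \<in> threads"
  shows "openin (FAS_inverse_limit \<epsilon> A) {D \<in> threads. D n \<subseteq> C n}"
proof -
  have "continuous_map (FAS_inverse_limit \<epsilon> A) (upper_semifinite_topology (level n)) (\<lambda>D. D n)"
    unfolding FAS_inverse_limit_eq
    by (intro continuous_map_from_subtopology continuous_map_product_projection) simp
  moreover have "openin (upper_semifinite_topology (level n)) {S \<in> level n. S \<subseteq> C n}"
    by (auto simp: openin_upper_semifinite_topology)
  ultimately have "openin (FAS_inverse_limit \<epsilon> A)
      {D \<in> topspace (FAS_inverse_limit \<epsilon> A). D n \<in> {S \<in> level n. S \<subseteq> C n}}"
    by (rule openin_continuous_map_preimage)
  moreover have "{D \<in> topspace (FAS_inverse_limit \<epsilon> A). D n \<in> {S \<in> level n. S \<subseteq> C n}} =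
      {D \<in> threads. D n \<subseteq> C n}"
    using threadD(1) by (auto simp: topspace_inverse_limit)
  ultimately show ?thesis by simp
qed

lemma continuous_map_thread_limit:
  "continuous_map (FAS_inverse_limit \<epsilon> A) (top_of_set X) thread_limit"
proof -
  have "openin (FAS_inverse_limit \<epsilon> A) {C \<in> threads. thread_limit C \<in> V}" if V: "open V" for V
  proof (subst openin_subopen, intro ballI)
    fix C assume "C \<in> {C \<in> threads. thread_limit C \<in> V}"
    then have C: "C \<in> threads" and "thread_limit C \<in> V" by auto
    then obtain e where e: "0 < e" "ball (thread_limit C) e \<subseteq> V"
      using V open_contains_ball by blast
    then obtain n where n: "\<epsilon> n < e / 12"
      using scale_below[of "e / 12" 0] by auto
    have "thread_limit D \<in> V" if D: "D \<in> threads" "D n \<subseteq> C n" for D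
    proof -
      obtain a where a: "a \<in> D n" using levelD(3)[OF threadD(1)[OF D(1)]] by blast
      have "dist (thread_limit D) a \<le> 6 * \<epsilon> n" "dist (thread_limit C) a \<le> 6 * \<epsilon> n"
        using thread_limit(2)[OF D(1), of n] thread_limit(2)[OF C, of n] a D(2) by auto
      then have "dist (thread_limit C) (thread_limit D) < e"
        using n dist_triangle2[of "thread_limit C" "thread_limit D" a] by simp
      then show ?thesis using e(2) by auto
    qed
    then show "\<exists>T. openin (FAS_inverse_limit \<epsilon> A) T \<and> C \<in> T \<and>
        T \<subseteq> {C \<in> threads. thread_limit C \<in> V}"
      using openin_thread_neighbourhood[OF C] C
      by (intro exI[of _ "{D \<in> threads. D n \<subseteq> C n}"]) auto
  qed
  then show ?thesis
    using thread_limit(1) unfolding continuous_map_in_subtopology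
    by (auto simp: continuous_map_def topspace_inverse_limit)
qed

lemma homeomorphic_inverse_limit: "FAS_inverse_limit \<epsilon> A homeomorphic_space top_of_set X"
proof -
  have "homeomorphic_maps (FAS_inverse_limit \<epsilon> A) (top_of_set X) thread_limit point_thread"
    unfolding homeomorphic_maps_def
    using continuous_map_thread_limit continuous_map_point_thread
    by (simp add: topspace_inverse_limit point_thread_thread_limit thread_limit_point_thread)
  then show ?thesis
    unfolding homeomorphic_space_def by blast
qed

end

section \<open>Existence of separated exhausting sequences\<close>

lemma finite_approximation_containing:
  assumes "compact X" "0 < e" "finite F" "F \<subseteq> X"
  obtains A where "finite_approximation X e A" "F \<subseteq> A"
proof -
  obtain k where k: "finite k" "k \<subseteq> X" "X \<subseteq> (\<Union>x\<in>k. ball x e)"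
    using seq_compact_imp_totally_bounded[OF compact_imp_seq_compact[OF assms(1)],
        rule_format, OF assms(2)]
    by (elim exE conjE)
  have "\<exists>a\<in>k \<union> F. dist x a < e" if "x \<in> X" for x
  proof -
    obtain a where "a \<in> k" "x \<in> ball a e" using k(3) \<open>x \<in> X\<close> by blast
    then show ?thesis by (intro bexI[of _ a]) (auto simp: dist_commute)
  qed
  then have "finite_approximation X e (k \<union> F)"
    using k assms by (simp add: finite_approximation_def)
  then show ?thesis using that by blast
qed

lemma finite_set_separation:
  fixes A :: "'a::metric_space set"
  assumes "finite A"
  obtains s where "0 < s" "\<And>a b. a \<in> A \<Longrightarrow> b \<in> A \<Longrightarrow> a \<noteq> b \<Longrightarrow> s \<le> dist a b"
proof -
  \<comment> \<open>The element 1 keeps the set nonempty when \<open>A\<close> has at most one point.\<close>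
  define D where "D = insert 1 ((\<lambda>(a, b). dist a b) ` {p \<in> A \<times> A. fst p \<noteq> snd p})"
  have "finite D"
    unfolding D_def using assms by simp
  have "D \<noteq> {}" "\<forall>d\<in>D. 0 < d"
    by (auto simp: D_def)
  show ?thesis
  proof (rule that)
    show "0 < Min D"
      using Min_in[OF \<open>finite D\<close> \<open>D \<noteq> {}\<close>] \<open>\<forall>d\<in>D. 0 < d\<close> by blast
    fix a b assume "a \<in> A" "b \<in> A" "a \<noteq> b"
    then have "dist a b \<in> D" by (force simp: D_def)
    then show "Min D \<le> dist a b" by (rule Min_le[OF \<open>finite D\<close>])
  qed
qed

text \<open>
  The approximations are chosen recursively: once \<open>A n\<close> is known, its covering radius and its
  separation bound \<open>\<epsilon> (Suc n)\<close>, and \<open>A (Suc n)\<close> is any \<open>\<epsilon> (Suc n)\<close>-approximation that contains an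
  initial segment of an enumeration of \<open>X\<close>. The segments exhaust \<open>X\<close>.
\<close>

lemma separated_exhausting_FAS_exists:
  fixes X :: "'a::metric_space set"
  assumes X: "compact X" "countable X"
  shows "\<exists>\<epsilon> A. separated_exhausting_FAS X \<epsilon> A"
proof -
  define F where "F n = {x \<in> X. to_nat_on X x < n}" for n
  have F: "finite (F n)" "F n \<subseteq> X" for n
  proof -
    have "inj_on (to_nat_on X) (F n)"
      by (rule inj_on_subset[OF inj_on_to_nat_on[OF X(2)]]) (auto simp: F_def)
    moreover have "to_nat_on X ` F n \<subseteq> {..<n}" by (auto simp: F_def)
    ultimately show "finite (F n)" by (meson finite_lessThan inj_on_finite)
  qed (auto simp: F_def)
  define P where "P n s \<longleftrightarrow>
    0 < fst s \<and> finite_approximation X (fst s) (snd s) \<and> F n \<subseteq> snd s" for n s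
  define Q where "Q s t \<longleftrightarrow>
    fst t < (fst s - covering_radius X (snd s)) / 2 \<and>
    (\<forall>a\<in>snd s. \<forall>b\<in>snd s. a \<noteq> b \<longrightarrow> 14 * fst t < dist a b)" for s t :: "real \<times> 'a set"
  have "\<exists>s. P 0 s"
  proof -
    obtain A where "finite_approximation X 1 A" "F 0 \<subseteq> A"
      using finite_approximation_containing[OF X(1) zero_less_one F] .
    then show ?thesis by (intro exI[of _ "(1, A)"]) (simp add: P_def)
  qed
  moreover have "\<exists>t. P (Suc n) t \<and> Q s t" if "P n s" for n s
  proof -
    obtain e A where s: "s = (e, A)" by (cases s)
    have eA: "0 < e" "finite_approximation X e A"
      using that by (auto simp: P_def s)
    obtain d where d: "0 < d" "\<And>a b. a \<in> A \<Longrightarrow> b \<in> A \<Longrightarrow> a \<noteq> b \<Longrightarrow> d \<le> dist a b"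
      using finite_set_separation eA(2) unfolding finite_approximation_def by blast
    have g: "covering_radius X A < e"
      by (rule covering_radius_less[OF X(1) eA])
    \<comment> \<open>Half of each admissible bound, \<open>(e - \<gamma>) / 2\<close> and \<open>d / 14\<close>, as both inequalities are strict.\<close>
    define e' where "e' = min ((e - covering_radius X A) / 4) (d / 28)"
    have e': "0 < e'" "e' < (e - covering_radius X A) / 2" "14 * e' < d"
      using g d(1) by (auto simp: e'_def min_def)
    obtain A' where "finite_approximation X e' A'" "F (Suc n) \<subseteq> A'"
      using finite_approximation_containing[OF X(1) e'(1) F] .
    then have "P (Suc n) (e', A')"
      using e'(1) by (simp add: P_def)
    moreover have "Q s (e', A')"
      using e'(2) order_less_le_trans[OF e'(3) d(2)] by (simp add: Q_def s)
    ultimately show ?thesis by blast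
  qed
  ultimately obtain f where f: "\<And>n. P n (f n)" "\<And>n. Q (f n) (f (Suc n))"
    using dependent_nat_choice[of P "\<lambda>_. Q"] by blast
  have "separated_exhausting_FAS X (\<lambda>n. fst (f n)) (\<lambda>n. snd (f n))"
  proof
    fix x assume "x \<in> X"
    then have "\<forall>n\<ge>Suc (to_nat_on X x). x \<in> F n" by (auto simp: F_def)
    moreover have "F n \<subseteq> snd (f n)" for n
      using f(1) by (simp add: P_def)
    ultimately show "\<exists>N. \<forall>n\<ge>N. x \<in> snd (f n)" by blast
  qed (use X(1) f in \<open>auto simp: P_def Q_def\<close>)
  then show ?thesis by blast
qed

theorem theorem3:
  fixes X :: "'a::metric_space set"
  assumes "compact X" and "countable X"
  shows "\<exists>\<epsilon> A. finite_approximative_sequence X \<epsilon> A \<and>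
           FAS_inverse_limit \<epsilon> A homeomorphic_space top_of_set X"
proof -
  obtain \<epsilon> A where "separated_exhausting_FAS X \<epsilon> A"
    using separated_exhausting_FAS_exists[OF assms] by blast
  then interpret separated_exhausting_FAS X \<epsilon> A .
  show ?thesis
    using is_FAS homeomorphic_inverse_limit by blast
qed

end
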